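(* Let $\alpha>-1$ and let $n$ be a positive integer. Let $x_1<x_2<\dots<x_n$ be the zeros of the Laguerre polynomial $L_n^{\alpha}$ on $(0,\infty)$, let $\Delta x_k=x_{k+1}-x_k$, and put $$t_0=\frac{\alpha^2-1}{\alpha+2n+1},\qquad F(t)=\frac{-t^2+2\alpha t+2t+4nt-\alpha^2+1}{4t^2}\quad (t>0).$$ Then the zeros of $L_n^{\alpha}$ on $(0,\infty)$ are: 1. all convex if $n>0$ and $-1<\alpha\le 3$; 2. all convex if $\alpha>3$ and $0<n<\frac{\alpha+1}{\alpha-3}$; 3. concave for $t<t_0$ (that is, on $(0,t_0)$) and convex for $t>t_0$ (that is, on $(t_0,\infty)$) when $\alpha>3$ and $n>\frac{\alpha+1}{\alpha-3}$. Moreover, for the distance between consecutive zeros we have the general estimate $$\Delta x_k>\frac{\pi\sqrt{2}}{\sqrt{2\alpha n+\alpha+2n^2+2n+1}},\qquad k=1,\dots,n-1,$$ and also, if $x_k>t_0$, then $$\Delta x_k>\frac{\pi}{\sqrt{F(x_k)}}\qquad (k=1,\dots,n-1)$$ and $$\Delta x_k<\frac{\pi}{\sqrt{F(x_{k+1})}}\qquad (k=1,\dots,n-2).$$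
   Context: For $\alpha>-1$, $L_n^{\alpha}$ is the Laguerre polynomial of degree $n$, orthogonal on $(0,\infty)$ with respect to the weight $t^{\alpha}e^{-t}$; it satisfies $tx''+(\alpha+1-t)x'+nx=0$ and has $n$ simple zeros, all in $(0,\infty)$. Convexity convention: the zeros of a function on an interval $(a,b)$, listed in increasing order as $x_1<x_2<\dots$ (only those lying in $(a,b)$), are called convex on $(a,b)$ if $x_{k+2}-x_{k+1}>x_{k+1}-x_k$ for every three consecutive zeros $x_k<x_{k+1}<x_{k+2}$ in $(a,b)$, and concave on $(a,b)$ if $x_{k+2}-x_{k+1}<x_{k+1}-x_k$ for every three consecutive zeros in $(a,b)$. "All convex" means convex on $(0,\infty)$. *)

theory Defs
  imports "HOL-Analysis.Analysis"
begin

text \<open>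
  \<^term>\<open>p\<close> is the Laguerre polynomial of degree \<^term>\<open>n\<close> with parameter \<^term>\<open>\<alpha> > -1\<close>, up to the choice
  of a normalisation. Normalisation does not affect the zeros, so none is fixed. For
  \<^term>\<open>\<alpha> > -1\<close> all the integrands are integrable.
\<close>

definition laguerre_poly :: "real \<Rightarrow> nat \<Rightarrow> real poly \<Rightarrow> bool" where
  "laguerre_poly \<alpha> n p \<longleftrightarrow>
     p \<noteq> 0 \<and> degree p = n \<and>
     (\<forall>q. degree q < n \<longrightarrow>
        (LBINT t:{0<..}. poly p t * poly q t * (t powr \<alpha> * exp (- t))) = 0)"

definition consecutive_zeros_on :: "(real \<Rightarrow> real) \<Rightarrow> real set \<Rightarrow> real \<Rightarrow> real \<Rightarrow> bool" where
  "consecutive_zeros_on f I u v \<longleftrightarrow>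
     u \<in> I \<and> v \<in> I \<and> u < v \<and> f u = 0 \<and> f v = 0 \<and> (\<forall>t\<in>I. u < t \<and> t < v \<longrightarrow> f t \<noteq> 0)"

definition zeros_convex_on :: "(real \<Rightarrow> real) \<Rightarrow> real set \<Rightarrow> bool" where
  "zeros_convex_on f I \<longleftrightarrow>
     (\<forall>u v w. consecutive_zeros_on f I u v \<and> consecutive_zeros_on f I v w \<longrightarrow> w - v > v - u)"

definition zeros_concave_on :: "(real \<Rightarrow> real) \<Rightarrow> real set \<Rightarrow> bool" where
  "zeros_concave_on f I \<longleftrightarrow>
     (\<forall>u v w. consecutive_zeros_on f I u v \<and> consecutive_zeros_on f I v w \<longrightarrow> w - v < v - u)"

definition laguerre_t0 :: "real \<Rightarrow> nat \<Rightarrow> real" where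
  "laguerre_t0 \<alpha> n = (\<alpha>\<^sup>2 - 1) / (\<alpha> + 2 * real n + 1)"

definition laguerre_F :: "real \<Rightarrow> nat \<Rightarrow> real \<Rightarrow> real" where
  "laguerre_F \<alpha> n t =
     (- (t\<^sup>2) + 2 * \<alpha> * t + 2 * t + 4 * real n * t - \<alpha>\<^sup>2 + 1) / (4 * t\<^sup>2)"

text \<open>
  For real \<^term>\<open>y \<le> 0\<close> the library has \<^prop>\<open>sqrt y \<le> 0\<close>, hence \<^prop>\<open>c / sqrt y \<le> 0\<close> for
  \<^prop>\<open>c \<ge> 0\<close>, and a lower bound \<^prop>\<open>d > pi / sqrt y\<close> would hold trivially for \<^prop>\<open>d > 0\<close>. The
  theorem therefore asserts positivity of the radicand along with every estimate in which the
  radicand is a value of \<^const>\<open>laguerre_F\<close>, which is what makes the estimate meaningful.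
\<close>

end

theory Submission
  imports Defs
begin

text \<open>
  Write $a = \alpha + 1$ and $y = L_n^\alpha$. Orthogonality forces the equation
  $t y'' + (a - t) y' + n y = 0$ (\<open>laguerre_poly_imp_ode\<close>), and only this equation, together with
  the fact that $y$ has $n$ distinct positive zeros, is used afterwards.

  Convexity and the estimates in terms of $F$. The function $u = t^{a/2} e^{-t/2} y$ has the same
  positive zeros as $y$ and satisfies $u'' + F u = 0$. Since $F'$ has the sign of $t_0 - t$ on
  $(0,\infty)$, a gap between zeros can be compared with the constant value of $F$ at one of its
  ends: where $F$ stays below a constant $M$ a gap is longer than $\pi / \sqrt{M}$, where $F$ stays
  above $M > 0$ it is shorter (\<open>sturm_gap_lower_bound\<close>, \<open>sturm_gap_upper_bound\<close>). Taking for $M$ the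
  value of $F$ at the common end of two adjacent gaps compares these gaps with each other, which
  gives concavity to the left of $t_0$ and convexity to the right of it. All zeros are convex as
  soon as all of them lie to the right of $t_0$. The equation at $t = 0$ says that
  $\sum_i 1/x_i = n/a$, so every zero is at least $a/n$, and $t_0 < a/n$ is equivalent to
  $n (\alpha - 3) < \alpha + 1$ (\<open>t0_less_zeros\<close>).

  The general estimate. Comparison with the maximum of $F$ does not give it, because $F$ is
  unbounded near $0$ for small $\alpha$. Instead, evaluating the equation and its derivative at a zero
  $z$ of $y$ gives the exact identity
  \[ 12 \sum_{x_j \neq z} \frac{1}{(z - x_j)^2} = -1 + \frac{2(2n+a)}{z} - \frac{a(a+4)}{z^2}, \]
  which is used at the right end $z = x_{k+1}$ of the gap, so that the left hand side is at least
  $12 / (\Delta x_k)^2$ and a good upper bound for $1/z \le 1/x_2$ suffices. Such a bound comes from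
  $W = y'' - y'$, which solves the Laguerre equation with parameters $(a + 2, n - 1)$ and has exactly
  one zero in each gap of $y$: the first zero $w_1$ of $W$ is smaller than $x_2$, and
  $1 / w_1^2 \le \sum_i 1 / w_i^2$, a rational function of $a$ and $n$
  (\<open>reciprocal_second_root_bound\<close>). As $a$ and then $1/n$ tend to $0$, what is needed becomes
  $\pi^2 \le 6 \sqrt{3}$, which is true but leaves little room.
\<close>

section \<open>Real-rooted polynomials with simple roots\<close>

text \<open>
  Polynomials that split into distinct linear factors are described throughout by a set of roots
  that is as large as the degree, so that statements go by induction on this set.
\<close>

lemma roots_eq_if_card_eq_degree:
  fixes p :: "real poly"
  assumes "finite A" "degree p = card A" "p \<noteq> 0" "\<And>r. r \<in> A \<Longrightarrow> poly p r = 0"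
  shows "{r. poly p r = 0} = A"
proof -
  have sub: "A \<subseteq> {r. poly p r = 0}" using assms(4) by auto
  have fin: "finite {r. poly p r = 0}" using assms(3) by (rule poly_roots_finite)
  have "card {r. poly p r = 0} \<le> card A"
    using card_poly_roots_bound[OF assms(3)] assms(2) by simp
  then show ?thesis using card_seteq[OF fin sub] by simp
qed

lemma pderiv_linear_mult:
  fixes q :: "real poly"
  shows "pderiv ([:-s, 1:] * q) = q + [:-s, 1:] * pderiv q"
  by (simp only: pderiv_mult pderiv_pCons) simp

lemma divide_out_root:
  fixes p :: "real poly"
  assumes "finite A" "degree p = card A" "p \<noteq> 0" "\<And>r. r \<in> A \<Longrightarrow> poly p r = 0" and "s \<in> A"
  obtains q where "p = [:-s, 1:] * q" "degree q = card (A - {s})" "q \<noteq> 0"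
    "\<And>r. r \<in> A - {s} \<Longrightarrow> poly q r = 0"
proof -
  obtain q where q: "p = [:-s, 1:] * q"
    using assms(4)[OF assms(5)] by (auto simp: poly_eq_0_iff_dvd dvd_def)
  have "q \<noteq> 0" using q assms(3) by auto
  have "degree p = Suc (degree q)"
    unfolding q using \<open>q \<noteq> 0\<close> by (subst degree_mult_eq) auto
  then have "degree q = card (A - {s})" using assms by simp
  moreover have "poly q r = 0" if "r \<in> A - {s}" for r
    using assms(4)[of r] that by (auto simp: q)
  ultimately show ?thesis using that q \<open>q \<noteq> 0\<close> by blast
qed

text \<open>
  These are the values at \<^term>\<open>z\<close> of $p'/p$ and $-(p'/p)'$, with denominators cleared. They turn
  what a differential equation says about the derivatives of \<^term>\<open>p\<close> at one point into power sums
  over the roots.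
\<close>

lemma log_derivatives_of_split_poly:
  fixes p :: "real poly"
  assumes "finite A" "degree p = card A" "p \<noteq> 0" "\<And>r. r \<in> A \<Longrightarrow> poly p r = 0" and "z \<notin> A"
  shows "poly (pderiv p) z = poly p z * (\<Sum>r\<in>A. 1 / (z - r))"
    and "(poly (pderiv p) z)\<^sup>2 - poly p z * poly (pderiv (pderiv p)) z
           = (poly p z)\<^sup>2 * (\<Sum>r\<in>A. 1 / (z - r)\<^sup>2)"
proof -
  have "poly (pderiv p) z = poly p z * (\<Sum>r\<in>A. 1 / (z - r)) \<and>
    (poly (pderiv p) z)\<^sup>2 - poly p z * poly (pderiv (pderiv p)) z
           = (poly p z)\<^sup>2 * (\<Sum>r\<in>A. 1 / (z - r)\<^sup>2)"
    using assms
  proof (induction A arbitrary: p rule: finite_induct)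
    case empty
    then obtain c where "p = [:c:]" by (auto elim: degree_eq_zeroE)
    then show ?case by (simp add: pderiv_pCons)
  next
    case (insert s A)
    obtain q where q: "p = [:-s, 1:] * q" "degree q = card (insert s A - {s})" "q \<noteq> 0"
      "\<And>r. r \<in> insert s A - {s} \<Longrightarrow> poly q r = 0"
      using divide_out_root[of "insert s A" p s] insert by auto
    have As: "insert s A - {s} = A" using insert by auto
    define S T where "S = (\<Sum>r\<in>A. 1 / (z - r))" and "T = (\<Sum>r\<in>A. 1 / (z - r)\<^sup>2)"
    have IH1: "poly (pderiv q) z = poly q z * S"
     and IH2: "poly q z * poly (pderiv (pderiv q)) z = (poly (pderiv q) z)\<^sup>2 - (poly q z)\<^sup>2 * T"
      using insert.IH[of q] q insert.prems unfolding As S_def T_def by (auto simp: algebra_simps)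
    define Y where "Y = poly (pderiv (pderiv q)) z"
    have zs: "z - s \<noteq> 0" using insert by auto
    have p0: "poly p z = (z - s) * poly q z" by (simp add: q algebra_simps)
    have p1: "poly (pderiv p) z = poly q z + (z - s) * poly (pderiv q) z"
      unfolding q pderiv_linear_mult pderiv_add by (simp_all add: algebra_simps)
    have p2: "poly (pderiv (pderiv p)) z = 2 * poly (pderiv q) z + (z - s) * poly (pderiv (pderiv q)) z"
      unfolding q pderiv_linear_mult pderiv_add by (simp_all add: algebra_simps)
    have "poly (pderiv p) z = poly p z * (1 / (z - s) + S)"
      unfolding p0 p1 IH1 using zs by (simp add: field_simps)
    moreover have "(poly (pderiv p) z)\<^sup>2 - poly p z * poly (pderiv (pderiv p)) z
        = (poly q z)\<^sup>2 + (z-s)\<^sup>2 * ((poly (pderiv q) z)\<^sup>2 - poly q z * poly (pderiv (pderiv q)) z)"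
      unfolding p0 p1 p2 by (simp add: algebra_simps power2_eq_square)
    then have "(poly (pderiv p) z)\<^sup>2 - poly p z * poly (pderiv (pderiv p)) z
        = (poly p z)\<^sup>2 * (1 / (z - s)\<^sup>2 + T)"
      unfolding IH2 p0 using zs by (simp add: power_mult_distrib distrib_left)
    ultimately show ?case using insert by (simp add: S_def T_def)
  qed
  then show "poly (pderiv p) z = poly p z * (\<Sum>r\<in>A. 1 / (z - r))"
    and "(poly (pderiv p) z)\<^sup>2 - poly p z * poly (pderiv (pderiv p)) z
           = (poly p z)\<^sup>2 * (\<Sum>r\<in>A. 1 / (z - r)\<^sup>2)" by auto
qed

text \<open>
  The logarithmic derivatives at a root \<^term>\<open>z\<close> are those of $q = p / (t - z)$, for which $q(z)$,
  $q'(z)$, $q''(z)$ are $p'(z)$, $p''(z)/2$, $p^{(3)}(z)/3$.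
\<close>

lemma inverse_square_gaps_of_split_poly:
  fixes p :: "real poly"
  assumes "finite A" "degree p = card A" "p \<noteq> 0" "\<And>r. r \<in> A \<Longrightarrow> poly p r = 0" and "z \<in> A"
  shows "poly (pderiv p) z \<noteq> 0"
    and "(poly (pderiv (pderiv p)) z)\<^sup>2 / 4 - poly (pderiv p) z * poly (pderiv (pderiv (pderiv p))) z / 3
           = (poly (pderiv p) z)\<^sup>2 * (\<Sum>r\<in>A - {z}. 1 / (z - r)\<^sup>2)"
proof -
  obtain q where q: "p = [:-z, 1:] * q" "degree q = card (A - {z})" "q \<noteq> 0"
      "\<And>r. r \<in> A - {z} \<Longrightarrow> poly q r = 0"
    using divide_out_root[OF assms] by blast
  have d1: "poly (pderiv p) z = poly q z"
    unfolding q pderiv_linear_mult pderiv_add by (simp_all add: algebra_simps)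
  have d2: "poly (pderiv (pderiv p)) z = 2 * poly (pderiv q) z"
    unfolding q pderiv_linear_mult pderiv_add by (simp_all add: algebra_simps)
  have d3: "poly (pderiv (pderiv (pderiv p))) z = 3 * poly (pderiv (pderiv q)) z"
    unfolding q pderiv_linear_mult pderiv_add by (simp_all add: algebra_simps)
  have "{r. poly q r = 0} = A - {z}"
    by (rule roots_eq_if_card_eq_degree) (use q assms in auto)
  then show "poly (pderiv p) z \<noteq> 0" unfolding d1 by auto
  show "(poly (pderiv (pderiv p)) z)\<^sup>2 / 4 - poly (pderiv p) z * poly (pderiv (pderiv (pderiv p))) z / 3
           = (poly (pderiv p) z)\<^sup>2 * (\<Sum>r\<in>A - {z}. 1 / (z - r)\<^sup>2)"
    using log_derivatives_of_split_poly(2)[of "A - {z}" q z] q assms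
    unfolding d1 d2 d3 by (simp add: power_mult_distrib)
qed

text \<open>
  With $p = (t - u)(t - v) s$ the derivatives are $(u - v) s(u)$ and $(v - u) s(v)$, and \<^term>\<open>s\<close>
  has no sign change on the interval from \<^term>\<open>u\<close> to \<^term>\<open>v\<close>.
\<close>

lemma derivative_alternates_at_consecutive_roots:
  fixes p :: "real poly"
  assumes "finite A" "degree p = card A" "p \<noteq> 0" "\<And>r. r \<in> A \<Longrightarrow> poly p r = 0"
    and "u \<in> A" "v \<in> A" "u < v" and gap: "\<And>r. u < r \<Longrightarrow> r < v \<Longrightarrow> poly p r \<noteq> 0"
  shows "poly (pderiv p) u * poly (pderiv p) v < 0"
proof -
  obtain q where q: "p = [:-u, 1:] * q" "degree q = card (A - {u})" "q \<noteq> 0"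
      "\<And>r. r \<in> A - {u} \<Longrightarrow> poly q r = 0"
    using divide_out_root[OF assms(1-5)] by blast
  have v: "v \<in> A - {u}" and fin: "finite (A - {u})" using assms by auto
  obtain s where s: "q = [:-v, 1:] * s" "degree s = card (A - {u} - {v})" "s \<noteq> 0"
      "\<And>r. r \<in> A - {u} - {v} \<Longrightarrow> poly s r = 0"
    using divide_out_root[OF fin q(2-4) v] by blast
  have rs: "{r. poly s r = 0} = A - {u} - {v}"
    by (rule roots_eq_if_card_eq_degree) (use s assms in auto)
  have ns: "poly s r \<noteq> 0" if "u \<le> r" "r \<le> v" for r
  proof
    assume "poly s r = 0"
    then have "r \<in> A - {u} - {v}" using rs by auto
    then show False using gap[of r] assms(4)[of r] that by auto
  qed
  have sp: "poly s u * poly s v > 0"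
  proof (rule ccontr)
    assume "\<not> ?thesis"
    moreover have "poly s u \<noteq> 0" "poly s v \<noteq> 0" using ns assms by auto
    ultimately have "poly s u * poly s v < 0" by (simp add: not_less order.order_iff_strict)
    then obtain r where "u < r" "r < v" "poly s r = 0"
      using poly_IVT[OF \<open>u < v\<close>] by blast
    then show False using ns by auto
  qed
  have d: "poly (pderiv p) u = (u - v) * poly s u" "poly (pderiv p) v = (v - u) * poly s v"
    unfolding q s pderiv_linear_mult pderiv_add by (simp_all add: algebra_simps)
  have "poly (pderiv p) u * poly (pderiv p) v = - ((v - u)\<^sup>2 * (poly s u * poly s v))"
    unfolding d by (simp add: power2_eq_square algebra_simps)
  then show ?thesis using sp \<open>u < v\<close> by (simp)
qed

section \<open>Polynomial solutions of the Laguerre equation\<close>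

text \<open>
  The parameter \<^term>\<open>a\<close> stands for $\alpha + 1$. The parameter \<^term>\<open>m\<close>, which for the Laguerre
  polynomial is its degree, is real so that differentiation can lower it by one without a side
  condition.
\<close>

definition laguerre_ode :: "real \<Rightarrow> real \<Rightarrow> real poly \<Rightarrow> bool" where
  "laguerre_ode a m p \<longleftrightarrow>
     [:0, 1:] * pderiv (pderiv p) + [:a, -1:] * pderiv p + smult m p = 0"

lemma laguerre_odeD:
  assumes "laguerre_ode a m p"
  shows "t * poly (pderiv (pderiv p)) t + (a - t) * poly (pderiv p) t + m * poly p t = 0"
proof -
  have "poly ([:0, 1:] * pderiv (pderiv p) + [:a, -1:] * pderiv p + smult m p) t = 0"
    using assms by (simp add: laguerre_ode_def)
  then show ?thesis by (simp add: algebra_simps)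
qed

lemma laguerre_odeI:
  assumes "\<And>t. t * poly (pderiv (pderiv p)) t + (a - t) * poly (pderiv p) t + m * poly p t = 0"
  shows "laguerre_ode a m p"
  unfolding laguerre_ode_def poly_eq_poly_eq_iff[symmetric]
  by (rule ext) (use assms in \<open>simp add: algebra_simps\<close>)

lemma laguerre_ode_pderiv:
  assumes "laguerre_ode a m p"
  shows "laguerre_ode (a + 1) (m - 1) (pderiv p)"
proof (rule laguerre_odeI)
  fix t
  have "pderiv ([:0, 1:] * pderiv (pderiv p) + [:a, -1:] * pderiv p + smult m p) =
      [:0, 1:] * pderiv (pderiv (pderiv p)) + pderiv (pderiv p)
        + ([:a, -1:] * pderiv (pderiv p) - pderiv p) + smult m (pderiv p)"
    by (simp only: pderiv_add pderiv_mult pderiv_smult pderiv_pCons) simp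
  also have "pderiv ([:0, 1:] * pderiv (pderiv p) + [:a, -1:] * pderiv p + smult m p) = 0"
    using assms by (simp add: laguerre_ode_def)
  finally have "poly ([:0, 1:] * pderiv (pderiv (pderiv p)) + pderiv (pderiv p)
        + ([:a, -1:] * pderiv (pderiv p) - pderiv p) + smult m (pderiv p)) t = 0"
    by simp
  then show "t * poly (pderiv (pderiv (pderiv p))) t + (a + 1 - t) * poly (pderiv (pderiv p)) t
      + (m - 1) * poly (pderiv p) t = 0"
    by (simp add: algebra_simps)
qed

text \<open>
  The polynomial form of $L_n^{\alpha+1} = L_n^\alpha - (L_n^\alpha)'$, up to sign: unlike
  differentiation, this raises the parameter without lowering the degree.
\<close>

lemma laguerre_ode_raise_parameter:
  assumes "laguerre_ode a m p"
  shows "laguerre_ode (a + 1) m (pderiv p - p)"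
proof (rule laguerre_odeI)
  fix t
  have d1: "pderiv (pderiv p - p) = pderiv (pderiv p) - pderiv p" by (rule pderiv_diff)
  have d2: "pderiv (pderiv (pderiv p - p)) = pderiv (pderiv (pderiv p)) - pderiv (pderiv p)"
    unfolding d1 by (rule pderiv_diff)
  show "t * poly (pderiv (pderiv (pderiv p - p))) t + (a + 1 - t) * poly (pderiv (pderiv p - p)) t
      + m * poly (pderiv p - p) t = 0"
    using laguerre_odeD[OF laguerre_ode_pderiv[OF assms], of t] laguerre_odeD[OF assms, of t]
    unfolding d2 unfolding d1 by (simp add: algebra_simps)
qed

text \<open>
  At $t = 0$ the equation and its derivative determine the ratios $p'(0)/p(0)$ and $p''(0)/p(0)$.
\<close>

lemma sum_inverse_roots:
  assumes ode: "laguerre_ode a m p" and a: "a > 0"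
    and A: "finite A" "degree p = card A" "p \<noteq> 0" "\<And>r. r \<in> A \<Longrightarrow> poly p r = 0" "0 \<notin> A"
  shows "(\<Sum>r\<in>A. 1 / r) = m / a"
    and "(\<Sum>r\<in>A. 1 / r\<^sup>2) = m * (m + a) / (a\<^sup>2 * (a + 1))"
proof -
  have "{r. poly p r = 0} = A" by (rule roots_eq_if_card_eq_degree) (use A in auto)
  then have p0: "poly p 0 \<noteq> 0" using A by auto
  have 1: "poly (pderiv p) 0 = - (m / a) * poly p 0"
    using laguerre_odeD[OF ode, of 0] a by (simp add: field_simps)
  have "(a + 1) * poly (pderiv (pderiv p)) 0 = (m - 1) * m / a * poly p 0"
    using laguerre_odeD[OF laguerre_ode_pderiv[OF ode], of 0] unfolding 1
    by (simp add: algebra_simps)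
  then have "poly (pderiv (pderiv p)) 0 = ((m - 1) * m / a * poly p 0) / (a + 1)"
    using a by (metis add_pos_pos less_irrefl nonzero_mult_div_cancel_left zero_less_one)
  then have 2: "poly (pderiv (pderiv p)) 0 = (m - 1) * m / (a * (a + 1)) * poly p 0"
    by simp
  have "poly (pderiv p) 0 = - (poly p 0 * (\<Sum>r\<in>A. 1 / r))"
    using log_derivatives_of_split_poly(1)[OF A] by (simp add: sum_negf)
  then have "poly p 0 * (\<Sum>r\<in>A. 1 / r) = poly p 0 * (m / a)"
    unfolding 1 by (simp only: minus_mult_left[symmetric] neg_equal_iff_equal mult.commute)
  then show "(\<Sum>r\<in>A. 1 / r) = m / a"
    by (simp only: p0 mult_cancel_left simp_thms)
  have "(poly p 0)\<^sup>2 * (\<Sum>r\<in>A. 1 / r\<^sup>2)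
      = (poly p 0)\<^sup>2 * ((m / a)\<^sup>2 - (m - 1) * m / (a * (a + 1)))"
    using log_derivatives_of_split_poly(2)[OF A] unfolding 1 2
    by (simp add: algebra_simps power2_eq_square)
  then have "(\<Sum>r\<in>A. 1 / r\<^sup>2) = (m / a)\<^sup>2 - (m - 1) * m / (a * (a + 1))"
    using p0 by simp
  also have "\<dots> = m * (m + a) / (a\<^sup>2 * (a + 1))"
  proof -
    define b where "b = a + 1"
    have "a \<noteq> 0" "b \<noteq> 0" using a by (auto simp: b_def)
    then have "(m / a)\<^sup>2 - (m - 1) * m / (a * b) = (m * m * b - (m - 1) * m * a) / (a\<^sup>2 * b)"
      by (simp add: field_simps power2_eq_square)
    also have "m * m * b - (m - 1) * m * a = m * (m + a)"
      by (simp add: b_def algebra_simps)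
    finally show ?thesis by (simp add: b_def)
  qed
  finally show "(\<Sum>r\<in>A. 1 / r\<^sup>2) = m * (m + a) / (a\<^sup>2 * (a + 1))" .
qed

text \<open>
  At a root $z$ the equation determines $p''/p'$, and its derivative then determines $p^{(3)}/p'$.
\<close>

lemma sum_inverse_square_gaps:
  assumes ode: "laguerre_ode a m p"
    and A: "finite A" "degree p = card A" "p \<noteq> 0" "\<And>r. r \<in> A \<Longrightarrow> poly p r = 0"
    and z: "z \<in> A" "z \<noteq> 0"
  shows "12 * (\<Sum>r\<in>A - {z}. 1 / (z - r)\<^sup>2) = - 1 + 2 * (2 * m + a) / z - a * (a + 4) / z\<^sup>2"
proof -
  define d where "d = poly (pderiv p) z"
  have d0: "d \<noteq> 0" unfolding d_def using inverse_square_gaps_of_split_poly(1)[OF A z(1)] .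
  have at_root: "z * poly (pderiv (pderiv p)) z + (a - z) * d = 0"
    using laguerre_odeD[OF ode, of z] A z by (simp add: d_def)
  define e h where "e = (z - a) / z" and "h = - ((a + 1 - z) * e + (m - 1)) / z"
  have 2: "poly (pderiv (pderiv p)) z = e * d"
    using at_root z by (simp add: e_def field_simps)
  have "z * poly (pderiv (pderiv (pderiv p))) z + (a + 1 - z) * (e * d) + (m - 1) * d = 0"
    using laguerre_odeD[OF laguerre_ode_pderiv[OF ode], of z] unfolding 2 d_def by simp
  then have "z * poly (pderiv (pderiv (pderiv p))) z = - ((a + 1 - z) * e + (m - 1)) * d"
    by (simp add: algebra_simps)
  then have 3: "poly (pderiv (pderiv (pderiv p))) z = h * d"
    unfolding h_def times_divide_eq_left using z by (simp add: eq_divide_eq mult.commute)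
  have "d\<^sup>2 * (\<Sum>r\<in>A - {z}. 1 / (z - r)\<^sup>2) = d\<^sup>2 * (e\<^sup>2 / 4 - h / 3)"
    using inverse_square_gaps_of_split_poly(2)[OF A z(1)] unfolding d_def[symmetric] 2 3
    by (simp add: algebra_simps power2_eq_square)
  then have "(\<Sum>r\<in>A - {z}. 1 / (z - r)\<^sup>2) = e\<^sup>2 / 4 - h / 3"
    using d0 by simp
  moreover have "12 * (e\<^sup>2 / 4 - h / 3) = - 1 + 2 * (2 * m + a) / z - a * (a + 4) / z\<^sup>2"
    unfolding h_def e_def using z by (simp add: field_simps power2_eq_square)
  ultimately show ?thesis by simp
qed

section \<open>From orthogonality to the differential equation\<close>

lemma weight_moment:
  fixes a :: real
  assumes "a > 0"
  shows "set_integrable lborel {0<..} (\<lambda>t. t ^ k * (t powr (a - 1) * exp (- t)))"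
    and "(LBINT t:{0<..}. t ^ k * (t powr (a - 1) * exp (- t))) = Gamma (a + real k)"
proof -
  let ?f = "\<lambda>t::real. t ^ k * (t powr (a - 1) * exp (- t))"
  have eq: "t powr (a + real k - 1) / exp t = ?f t" if "t \<in> {0<..}" for t
    using that by (simp add: powr_diff powr_add powr_realpow exp_minus field_simps)
  have "((\<lambda>t. t powr (a + real k - 1) / exp t) has_integral Gamma (a + real k)) {0..}"
    using assms by (intro Gamma_integral_real) auto
  then have "((\<lambda>t. if t \<in> {0<..} then t powr (a + real k - 1) / exp t else 0)
      has_integral Gamma (a + real k)) {0..}"
    by (rule has_integral_spike[of "{0}", rotated 2]) auto
  then have "((\<lambda>t. t powr (a + real k - 1) / exp t) has_integral Gamma (a + real k)) {0<..}"
    by (subst (asm) has_integral_restrict) auto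
  then have int: "(?f has_integral Gamma (a + real k)) {0<..}"
    by (rule has_integral_cong[THEN iffD1, rotated]) (use eq in auto)
  have "?f absolutely_integrable_on {0<..}"
    using int by (intro nonnegative_absolutely_integrable_1) auto
  moreover have "(\<lambda>t. indicator {0<..} t *\<^sub>R ?f t) \<in> borel_measurable lborel"
    by measurable
  ultimately show *: "set_integrable lborel {0<..} ?f"
    unfolding set_integrable_def by (simp add: integrable_completion)
  show "(LBINT t:{0<..}. ?f t) = Gamma (a + real k)"
    using set_borel_integral_eq_integral(2)[OF *] int by (simp add: integral_unique)
qed

definition laguerre_functional :: "real \<Rightarrow> real poly \<Rightarrow> real" where
  "laguerre_functional a s = (LBINT t:{0<..}. poly s t * (t powr (a - 1) * exp (- t)))"

lemma poly_weight_integrable: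
  fixes a :: real
  assumes "a > 0"
  shows "set_integrable lborel {0<..} (\<lambda>t. poly s t * (t powr (a - 1) * exp (- t)))"
proof -
  have "set_integrable lborel {0<..}
      (\<lambda>t. \<Sum>i\<le>degree s. coeff s i * (t ^ i * (t powr (a - 1) * exp (- t))))"
    unfolding set_integrable_def scaleR_sum_right
    using weight_moment(1)[OF assms] unfolding set_integrable_def
    by (intro Bochner_Integration.integrable_sum) (simp add: mult.left_commute)
  then show ?thesis by (simp add: poly_altdef sum_distrib_right mult.assoc)
qed

lemma laguerre_functional_add:
  assumes "a > 0"
  shows "laguerre_functional a (p + q) = laguerre_functional a p + laguerre_functional a q"
  unfolding laguerre_functional_def poly_add distrib_right
  by (rule set_integral_add(2)) (use assms in \<open>auto intro: poly_weight_integrable\<close>)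

lemma laguerre_functional_smult:
  "laguerre_functional a (smult c p) = c * laguerre_functional a p"
  unfolding laguerre_functional_def poly_smult mult.assoc by simp

lemma laguerre_functional_monom:
  assumes "a > 0"
  shows "laguerre_functional a (monom c k) = c * Gamma (a + real k)"
proof -
  have "laguerre_functional a (smult c (monom 1 k)) = c * Gamma (a + real k)"
    unfolding laguerre_functional_smult
    by (simp add: laguerre_functional_def poly_monom weight_moment(2)[OF assms])
  then show ?thesis by (simp add: smult_monom)
qed

text \<open>
  For the weight $w = t^{a-1} e^{-t}$ the integrand is $(t\,w\,s)'$, and $t\,w\,s$ vanishes at both
  ends. For monomials this is the recurrence of the Gamma function, so no boundary terms have to
  be discussed.
\<close>

lemma laguerre_functional_total_derivative:
  assumes "a > 0"
  shows "laguerre_functional a ([:0, 1:] * pderiv s + [:a, -1:] * s) = 0"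
proof -
  have mono: "laguerre_functional a ([:0, 1:] * pderiv (monom c k) + [:a, -1:] * monom c k) = 0"
    for c k
  proof -
    have "[:0, 1:] * pderiv (monom c k) + [:a, -1:] * monom c k
        = monom ((real k + a) * c) k + monom (- c) (Suc k)"
      by (rule poly_eqI) (auto simp: coeff_pderiv coeff_pCons algebra_simps split: nat.splits)
    moreover have "Gamma (1 + (a + real k)) = (a + real k) * Gamma (a + real k)"
      using Gamma_plus1[of "a + real k"] assms
      by (metis add.commute add_pos_nonneg less_irrefl nonpos_Ints_nonpos not_le of_nat_0_le_iff)
    ultimately show ?thesis
      using assms by (simp add: laguerre_functional_add laguerre_functional_monom algebra_simps)
  qed
  have "laguerre_functional a ([:0, 1:] * pderiv (\<Sum>i\<le>d. monom (coeff s i) i)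
      + [:a, -1:] * (\<Sum>i\<le>d. monom (coeff s i) i)) = 0" for d
  proof (induction d)
    case 0
    show ?case using mono[of "coeff s 0" 0] by simp
  next
    case (Suc d)
    define p q where "p = (\<Sum>i\<le>d. monom (coeff s i) i)" and "q = monom (coeff s (Suc d)) (Suc d)"
    have "[:0, 1:] * pderiv (p + q) + [:a, -1:] * (p + q)
        = ([:0, 1:] * pderiv p + [:a, -1:] * p) + ([:0, 1:] * pderiv q + [:a, -1:] * q)"
      by (simp only: pderiv_add distrib_left add_ac)
    then show ?case
      using Suc mono[of "coeff s (Suc d)" "Suc d"] assms
      by (simp only: sum.atMost_Suc p_def[symmetric] q_def[symmetric] laguerre_functional_add)
  qed
  from this[of "degree s"] show ?thesis by (simp only: poly_as_sum_of_monoms)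
qed

lemma laguerre_functional_square_eq_0:
  assumes "a > 0" "laguerre_functional a (r * r) = 0"
  shows "r = 0"
proof (rule ccontr)
  assume "r \<noteq> 0"
  let ?g = "\<lambda>t. indicator {0<..} t *\<^sub>R (poly (r * r) t * (t powr (a - 1) * exp (- t)))"
  have "integrable lborel ?g" "AE t in lborel. 0 \<le> ?g t"
    using poly_weight_integrable[OF assms(1), of "r * r"] by (auto simp: set_integrable_def)
  then have "AE t in lborel. ?g t = 0"
    using assms(2) integral_nonneg_eq_0_iff_AE[of lborel ?g]
    by (simp add: laguerre_functional_def set_lebesgue_integral_def)
  then have "AE t in lborel. t \<notin> {0<..} - {t. poly r t = 0}"
    by eventually_elim (auto split: split_indicator_asm)
  moreover have "AE t in lborel. t \<notin> {t. poly r t = 0}"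
    using poly_roots_finite[OF \<open>r \<noteq> 0\<close>]
    by (intro AE_not_in finite_imp_null_set_lborel) auto
  ultimately have "AE t in lborel. t \<notin> {0<..<1::real}"
    by eventually_elim auto
  then have "emeasure lborel {0<..<1::real} = 0"
    by (subst (asm) AE_iff_measurable[of "{0<..<1}"]) auto
  then show False by simp
qed

text \<open>
  The operator $D q = t q'' + (a - t) q'$ is symmetric for the Laguerre inner product, because
  $q\,D p - p\,D q$ is a total derivative, and it does not raise degrees. Hence $r = D p + n p$ is
  orthogonal to all polynomials of degree below $n$. But $r$ itself has degree below $n$, as the
  leading terms cancel, so that $r$ is orthogonal to itself.
\<close>

lemma laguerre_poly_imp_ode:
  assumes alpha: "\<alpha> > -1" and n: "n > 0" and L: "laguerre_poly \<alpha> n p"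
  shows "laguerre_ode (\<alpha> + 1) (real n) p"
proof -
  define a where "a = \<alpha> + 1"
  have a: "a > 0" using alpha by (simp add: a_def)
  define D where "D = (\<lambda>q :: real poly. [:0, 1:] * pderiv (pderiv q) + [:a, -1:] * pderiv q)"
  have coeff_D: "coeff (D q) i = (real i + 1) * (real i + a) * coeff q (Suc i) - real i * coeff q i" for q i
    by (cases i) (simp_all add: D_def coeff_pderiv algebra_simps)
  have orth: "laguerre_functional a (p * q) = 0" if "degree q < n" for q
    using L that by (simp add: laguerre_poly_def laguerre_functional_def a_def)
  have sym: "laguerre_functional a (D p * q) = laguerre_functional a (p * D q)" for q
  proof -
    \<comment> \<open>$q\,D p - p\,D q = t s' + (a - t) s$ for the Wronskian $s$.\<close>
    define s where "s = pderiv p * q - p * pderiv q"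
    have "D p * q = p * D q + ([:0, 1:] * pderiv s + [:a, -1:] * s)"
      by (simp only: D_def s_def pderiv_diff pderiv_mult) algebra
    then show ?thesis
      using a laguerre_functional_add[OF a, of "p * D q"]
      by (simp only: laguerre_functional_total_derivative add_0_right)
  qed
  define r where "r = D p + smult (real n) p"
  have deg_p: "degree p = n" using L by (simp add: laguerre_poly_def)
  have "degree r < n"
  proof -
    have "coeff r i = 0" if "i \<ge> n" for i
    proof (cases "i = n")
      case True
      then show ?thesis using deg_p by (simp add: r_def coeff_D coeff_eq_0)
    next
      case False
      then show ?thesis using deg_p that by (simp add: r_def coeff_D coeff_eq_0)
    qed
    then have "degree r \<le> n - 1" by (intro degree_le) auto
    then show ?thesis using n by simp
  qed
  have "degree (D r) \<le> degree r"
    by (intro degree_le) (simp add: coeff_D coeff_eq_0)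
  then have "degree (D r) < n" using \<open>degree r < n\<close> by simp
  have "r * r = (D p + smult (real n) p) * r" by (simp only: r_def)
  then have "r * r = D p * r + smult (real n) (p * r)"
    by (simp only: distrib_right mult_smult_left)
  then have "laguerre_functional a (r * r) = laguerre_functional a (D p * r + smult (real n) (p * r))"
    by (rule arg_cong)
  also have "\<dots> = 0"
    using a orth[OF \<open>degree r < n\<close>] orth[OF \<open>degree (D r) < n\<close>]
    by (simp add: laguerre_functional_add laguerre_functional_smult sym)
  finally have "r = 0" using laguerre_functional_square_eq_0 a by blast
  then show ?thesis by (simp add: laguerre_ode_def r_def D_def a_def)
qed

section \<open>Sturm comparison with a sine wave\<close>

text \<open>
  The function is the Wronskian of \<^term>\<open>u\<close> and of the solution $\sin(K(t - c))$ of
  $v'' + K^2 v = 0$ that vanishes at \<^term>\<open>c\<close>.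
\<close>

lemma sturm_wronskian_derivative:
  fixes u u' :: "real \<Rightarrow> real"
  assumes "(u has_real_derivative u' t) (at t)" "(u' has_real_derivative - G * u t) (at t)"
  shows "((\<lambda>t. u' t * sin (K * (t - c)) - u t * (K * cos (K * (t - c))))
           has_real_derivative (K\<^sup>2 - G) * u t * sin (K * (t - c))) (at t)"
  by (rule derivative_eq_intros assms refl)+ (simp add: algebra_simps power2_eq_square)

text \<open>
  If the gap were at most $\pi / K$, the sine would be positive inside it, and the Wronskian would
  increase from $0$ to $u'(d) \sin(K(d - c)) \le 0$.
\<close>

lemma sturm_gap_lower_bound_pos:
  fixes u u' G :: "real \<Rightarrow> real"
  assumes "c < d" and u: "\<And>t. t \<in> {c..d} \<Longrightarrow> (u has_real_derivative u' t) (at t)"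
    and u': "\<And>t. t \<in> {c..d} \<Longrightarrow> (u' has_real_derivative - G t * u t) (at t)"
    and zeros: "u c = 0" "u d = 0" and pos: "\<And>t. t \<in> {c<..<d} \<Longrightarrow> u t > 0"
    and G: "\<And>t. t \<in> {c<..<d} \<Longrightarrow> G t < K\<^sup>2" and K: "K > 0"
  shows "d - c > pi / K"
proof (rule ccontr)
  assume "\<not> ?thesis"
  then have len: "K * (d - c) \<le> pi" using K by (simp add: field_simps)
  define W where "W = (\<lambda>t. u' t * sin (K * (t - c)) - u t * (K * cos (K * (t - c))))"
  have W: "(W has_real_derivative (K\<^sup>2 - G t) * u t * sin (K * (t - c))) (at t)"
    if "t \<in> {c..d}" for t
    unfolding W_def by (rule sturm_wronskian_derivative[OF u[OF that] u'[OF that]])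
  have "W c < W d"
  proof (rule DERIV_pos_imp_increasing_open[OF \<open>c < d\<close>])
    fix t assume t: "c < t" "t < d"
    have "K * (t - c) < K * (d - c)" using K t by simp
    then have "sin (K * (t - c)) > 0" using K t len by (intro sin_gt_zero) (simp, linarith)
    then have "(K\<^sup>2 - G t) * u t * sin (K * (t - c)) > 0"
      using pos[of t] G[of t] t by simp
    then show "\<exists>y. (W has_real_derivative y) (at t) \<and> y > 0" using W[of t] t by auto
  next
    show "continuous_on {c..d} W"
      using W by (intro DERIV_continuous_on) (auto intro: has_field_derivative_at_within)
  qed
  moreover have "W c = 0" by (simp add: W_def zeros)
  moreover have "W d \<le> 0"
  proof -
    have "u' d \<le> 0"
    proof (rule ccontr)
      assume "\<not> u' d \<le> 0"
      then obtain e where e: "e > 0" "\<And>h. h > 0 \<Longrightarrow> h < e \<Longrightarrow> u (d - h) < u d"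
        using DERIV_pos_inc_left[OF u[of d]] \<open>c < d\<close> by auto
      define h where "h = min (e / 2) ((d - c) / 2)"
      have "h > 0" "h < e" "h < d - c" using e(1) \<open>c < d\<close> by (auto simp: h_def min_def)
      then show False using e(2)[of h] pos[of "d - h"] zeros by auto
    qed
    moreover have "sin (K * (d - c)) \<ge> 0" using K len \<open>c < d\<close> by (intro sin_ge_zero) auto
    ultimately show ?thesis by (simp add: W_def zeros mult_nonpos_nonneg)
  qed
  ultimately show False by simp
qed

text \<open>
  If the gap were at least $\pi / K$, the Wronskian would decrease from $0$ on the first half wave
  of the sine, at whose end it equals $K u \ge 0$.
\<close>

lemma sturm_gap_upper_bound_pos:
  fixes u u' G :: "real \<Rightarrow> real"
  assumes "c < d" and u: "\<And>t. t \<in> {c..d} \<Longrightarrow> (u has_real_derivative u' t) (at t)"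
    and u': "\<And>t. t \<in> {c..d} \<Longrightarrow> (u' has_real_derivative - G t * u t) (at t)"
    and zeros: "u c = 0" "u d = 0" and pos: "\<And>t. t \<in> {c<..<d} \<Longrightarrow> u t > 0"
    and G: "\<And>t. t \<in> {c<..<d} \<Longrightarrow> G t > K\<^sup>2" and K: "K > 0"
  shows "d - c < pi / K"
proof (rule ccontr)
  assume long: "\<not> d - c < pi / K"
  define e where "e = c + pi / K"
  have e: "c < e" "e \<le> d" "K * (e - c) = pi"
    using K long by (auto simp: e_def field_simps)
  define W where "W = (\<lambda>t. u' t * sin (K * (t - c)) - u t * (K * cos (K * (t - c))))"
  have W: "(W has_real_derivative (K\<^sup>2 - G t) * u t * sin (K * (t - c))) (at t)"
    if "t \<in> {c..e}" for t
    unfolding W_def using that e by (intro sturm_wronskian_derivative u u') auto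
  have "W c > W e"
  proof (rule DERIV_neg_imp_decreasing_open[OF \<open>c < e\<close>])
    fix t assume t: "c < t" "t < e"
    have "K * (t - c) < K * (e - c)" using K t by simp
    then have "sin (K * (t - c)) > 0" using K t e by (intro sin_gt_zero) (simp, linarith)
    then have "(K\<^sup>2 - G t) * u t * sin (K * (t - c)) < 0"
      using pos[of t] G[of t] t e by (simp add: mult_neg_pos)
    then show "\<exists>y. (W has_real_derivative y) (at t) \<and> y < 0" using W[of t] t by auto
  next
    show "continuous_on {c..e} W"
      using W by (intro DERIV_continuous_on) (auto intro: has_field_derivative_at_within)
  qed
  moreover have "W c = 0" by (simp add: W_def zeros)
  moreover have "u e \<ge> 0" using pos[of e] e zeros by (cases "e = d") auto
  then have "W e \<ge> 0" using e K by (simp add: W_def)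
  ultimately show False by simp
qed

text \<open>
  Solutions of a linear equation may be multiplied by $-1$, so the comparison may assume them
  positive between two consecutive zeros.
\<close>

lemma solution_sign_between_zeros:
  fixes u u' G :: "real \<Rightarrow> real"
  assumes "c < d" and u: "\<And>t. t \<in> {c..d} \<Longrightarrow> (u has_real_derivative u' t) (at t)"
    and u': "\<And>t. t \<in> {c..d} \<Longrightarrow> (u' has_real_derivative - G t * u t) (at t)"
    and zeros: "u c = 0" "u d = 0" and nz: "\<And>t. t \<in> {c<..<d} \<Longrightarrow> u t \<noteq> 0"
  obtains v v' where "\<And>t. t \<in> {c..d} \<Longrightarrow> (v has_real_derivative v' t) (at t)"
    "\<And>t. t \<in> {c..d} \<Longrightarrow> (v' has_real_derivative - G t * v t) (at t)"
    "v c = 0" "v d = 0" "\<And>t. t \<in> {c<..<d} \<Longrightarrow> v t > (0::real)"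
proof -
  define s where "s = sgn (u ((c + d) / 2))"
  have mid: "(c + d) / 2 \<in> {c<..<d}" using \<open>c < d\<close> by auto
  then have s0: "s \<noteq> 0" "s * u ((c + d) / 2) > 0"
    using nz[OF mid] by (auto simp: s_def sgn_if)
  have cont: "continuous_on {c<..<d} (\<lambda>t. s * u t)"
    by (intro continuous_intros DERIV_continuous_on[of _ u u'])
       (rule has_field_derivative_at_within[OF u], auto)
  have "s * u t > 0" if t: "t \<in> {c<..<d}" for t
  proof (rule ccontr)
    assume "\<not> ?thesis"
    moreover have "connected ((\<lambda>t. s * u t) ` {c<..<d})"
      using cont by (intro connected_continuous_image) auto
    ultimately have "0 \<in> (\<lambda>t. s * u t) ` {c<..<d}"
      using s0(2) connectedD_interval[OF _ imageI[OF t] imageI[OF mid], of "\<lambda>t. s * u t" 0]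
      by simp
    then show False using nz s0 by auto
  qed
  moreover have "((\<lambda>t. s * u t) has_real_derivative s * u' t) (at t)" if "t \<in> {c..d}" for t
    by (rule derivative_eq_intros u[OF that] refl)+ simp
  moreover have "((\<lambda>t. s * u' t) has_real_derivative - G t * (s * u t)) (at t)" if "t \<in> {c..d}" for t
    by (rule derivative_eq_intros u'[OF that] refl)+ simp
  ultimately show ?thesis using that[of "\<lambda>t. s * u t" "\<lambda>t. s * u' t"] zeros by simp
qed

text \<open>
  Two zeros cannot occur where \<^term>\<open>G\<close> is negative, which excludes $M \le 0$: otherwise the
  comparison with $K = \pi / (d - c)$ would make the gap longer than itself.
\<close>

lemma sturm_gap_lower_bound:
  fixes u u' G :: "real \<Rightarrow> real"
  assumes "c < d" and u: "\<And>t. t \<in> {c..d} \<Longrightarrow> (u has_real_derivative u' t) (at t)"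
    and u': "\<And>t. t \<in> {c..d} \<Longrightarrow> (u' has_real_derivative - G t * u t) (at t)"
    and zeros: "u c = 0" "u d = 0" and nz: "\<And>t. t \<in> {c<..<d} \<Longrightarrow> u t \<noteq> 0"
    and G: "\<And>t. t \<in> {c<..<d} \<Longrightarrow> G t < M"
  shows "M > 0" "d - c > pi / sqrt M"
proof -
  obtain v v' where v: "\<And>t. t \<in> {c..d} \<Longrightarrow> (v has_real_derivative v' t) (at t)"
    "\<And>t. t \<in> {c..d} \<Longrightarrow> (v' has_real_derivative - G t * v t) (at t)"
    "v c = 0" "v d = 0" "\<And>t. t \<in> {c<..<d} \<Longrightarrow> v t > (0::real)"
    using solution_sign_between_zeros[OF \<open>c < d\<close> u u' zeros nz] by metis
  show "M > 0"
  proof (rule ccontr)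
    assume "\<not> M > 0"
    then have "G t < (pi / (d - c))\<^sup>2" if "t \<in> {c<..<d}" for t
      using G[OF that] zero_le_power2[of "pi / (d - c)"] by linarith
    moreover have "pi / (d - c) > 0" using \<open>c < d\<close> by simp
    ultimately have "d - c > pi / (pi / (d - c))"
      using sturm_gap_lower_bound_pos[OF \<open>c < d\<close> v] by blast
    then show False by simp
  qed
  then show "d - c > pi / sqrt M"
    using sturm_gap_lower_bound_pos[OF \<open>c < d\<close> v, of "sqrt M"] G by simp
qed

lemma sturm_gap_upper_bound:
  fixes u u' G :: "real \<Rightarrow> real"
  assumes "c < d" and u: "\<And>t. t \<in> {c..d} \<Longrightarrow> (u has_real_derivative u' t) (at t)"
    and u': "\<And>t. t \<in> {c..d} \<Longrightarrow> (u' has_real_derivative - G t * u t) (at t)"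
    and zeros: "u c = 0" "u d = 0" and nz: "\<And>t. t \<in> {c<..<d} \<Longrightarrow> u t \<noteq> 0"
    and G: "\<And>t. t \<in> {c<..<d} \<Longrightarrow> G t > M" and M: "M > 0"
  shows "d - c < pi / sqrt M"
proof -
  obtain v v' where v: "\<And>t. t \<in> {c..d} \<Longrightarrow> (v has_real_derivative v' t) (at t)"
    "\<And>t. t \<in> {c..d} \<Longrightarrow> (v' has_real_derivative - G t * v t) (at t)"
    "v c = 0" "v d = 0" "\<And>t. t \<in> {c<..<d} \<Longrightarrow> v t > (0::real)"
    using solution_sign_between_zeros[OF \<open>c < d\<close> u u' zeros nz] by metis
  show ?thesis
    using sturm_gap_upper_bound_pos[OF \<open>c < d\<close> v, of "sqrt M"] G M by simp
qed

section \<open>Convexity and concavity of the zeros\<close>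

text \<open>
  As a function of $1/t$, $F$ is a quadratic polynomial whose vertex, for $t_0 \neq 0$, is at
  $1/t_0$; monotonicity on both sides of $t_0$ can be read off this form without differentiating.
\<close>

lemma laguerre_F_eq_t0:
  assumes "t > 0" "\<alpha> + 2 * real n + 1 > 0"
  shows "laguerre_F \<alpha> n t
    = - 1 / 4 + (\<alpha> + 2 * real n + 1) / 4 * (2 * (1 / t) - laguerre_t0 \<alpha> n * (1 / t)\<^sup>2)"
proof -
  define N b where "N = \<alpha> + 2 * real n + 1" and "b = laguerre_t0 \<alpha> n"
  have Nb: "N * b = \<alpha>\<^sup>2 - 1"
    using assms by (simp add: N_def b_def laguerre_t0_def)
  have "laguerre_F \<alpha> n t = - 1 / 4 + (N * (2 * (1 / t)) - (\<alpha>\<^sup>2 - 1) * (1 / t)\<^sup>2) / 4"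
    using assms(1) by (simp add: laguerre_F_def N_def field_simps power2_eq_square)
  also have "\<dots> = - 1 / 4 + N / 4 * (2 * (1 / t) - b * (1 / t)\<^sup>2)"
    unfolding Nb[symmetric] by (simp add: field_simps)
  finally show ?thesis by (simp only: N_def b_def)
qed

lemma laguerre_F_diff:
  assumes "s > 0" "t > 0" "\<alpha> + 2 * real n + 1 > 0"
  shows "laguerre_F \<alpha> n s - laguerre_F \<alpha> n t = (\<alpha> + 2 * real n + 1) / 4 *
    ((1 / s - 1 / t) * ((1 - laguerre_t0 \<alpha> n / s) + (1 - laguerre_t0 \<alpha> n / t)))"
proof -
  define N b x y where "N = \<alpha> + 2 * real n + 1" and "b = laguerre_t0 \<alpha> n"
    and "x = 1 / s" and "y = 1 / t"
  have "(N / 4 * (2 * x - b * x\<^sup>2)) - (N / 4 * (2 * y - b * y\<^sup>2))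
      = N / 4 * ((x - y) * ((1 - b * x) + (1 - b * y)))"
    by (simp add: field_simps power2_eq_square)
  then show ?thesis
    unfolding laguerre_F_eq_t0[OF assms(1,3)] laguerre_F_eq_t0[OF assms(2,3)]
    by (simp add: N_def b_def x_def y_def)
qed

lemma laguerre_F_decreasing:
  assumes "\<alpha> + 2 * real n + 1 > 0" "0 < s" "laguerre_t0 \<alpha> n \<le> s" "s < t"
  shows "laguerre_F \<alpha> n t < laguerre_F \<alpha> n s"
proof -
  have "(1 / s - 1 / t) * ((1 - laguerre_t0 \<alpha> n / s) + (1 - laguerre_t0 \<alpha> n / t)) > 0"
    using assms by (intro mult_pos_pos add_nonneg_pos) (auto simp: field_simps)
  then have "laguerre_F \<alpha> n s - laguerre_F \<alpha> n t > 0"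
    using assms by (subst laguerre_F_diff) auto
  then show ?thesis by simp
qed

lemma laguerre_F_increasing:
  assumes "\<alpha> + 2 * real n + 1 > 0" "0 < s" "s < t" "t \<le> laguerre_t0 \<alpha> n"
  shows "laguerre_F \<alpha> n s < laguerre_F \<alpha> n t"
proof -
  have "(1 / s - 1 / t) * ((1 - laguerre_t0 \<alpha> n / s) + (1 - laguerre_t0 \<alpha> n / t)) < 0"
    using assms by (intro mult_pos_neg add_neg_nonpos) (auto simp: field_simps)
  then have "laguerre_F \<alpha> n s - laguerre_F \<alpha> n t < 0"
    using assms by (subst laguerre_F_diff) (auto simp: mult_pos_neg)
  then show ?thesis by simp
qed

text \<open>
  The substitution that removes the first derivative from the Laguerre equation with parameter
  \<^term>\<open>a\<close>.
\<close>

definition laguerre_normal_form :: "real \<Rightarrow> real poly \<Rightarrow> real \<Rightarrow> real" where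
  "laguerre_normal_form a p t = t powr (a / 2) * exp (- t / 2) * poly p t"

definition laguerre_normal_form_deriv :: "real \<Rightarrow> real poly \<Rightarrow> real \<Rightarrow> real" where
  "laguerre_normal_form_deriv a p t = t powr (a / 2) * exp (- t / 2)
     * ((a / (2 * t) - 1 / 2) * poly p t + poly (pderiv p) t)"

lemma laguerre_factor_deriv:
  assumes "t > 0"
  shows "((\<lambda>t. t powr (a / 2) * exp (- t / 2)) has_real_derivative
    t powr (a / 2) * exp (- t / 2) * (a / (2 * t) - 1 / 2)) (at t)"
proof -
  have "t powr (a / 2 - 1) = t powr (a / 2) / t" using assms by (simp add: powr_diff)
  then show ?thesis
    using assms by (auto intro!: derivative_eq_intros simp: field_simps)
qed

lemma laguerre_normal_form_deriv1:
  assumes "t > 0"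
  shows "(laguerre_normal_form a p has_real_derivative laguerre_normal_form_deriv a p t) (at t)"
  unfolding laguerre_normal_form_def [abs_def] laguerre_normal_form_deriv_def
  by (rule derivative_eq_intros laguerre_factor_deriv[OF assms] poly_DERIV refl)+
     (simp add: algebra_simps)

lemma laguerre_normal_form_deriv2:
  assumes ode: "laguerre_ode (\<alpha> + 1) (real n) p" and t: "t > 0"
  shows "(laguerre_normal_form_deriv (\<alpha> + 1) p has_real_derivative
    - laguerre_F \<alpha> n t * laguerre_normal_form (\<alpha> + 1) p t) (at t)"
proof -
  define a g h where "a = \<alpha> + 1" and "g = t powr (a / 2) * exp (- t / 2)" and "h = a / (2 * t) - 1 / 2"
  define P0 P1 P2 where "P0 = poly p t" and "P1 = poly (pderiv p) t" and "P2 = poly (pderiv (pderiv p)) t"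
  have "((\<lambda>t. a / (2 * t) - 1 / 2) has_real_derivative - a / (2 * t\<^sup>2)) (at t)"
    using t by (auto intro!: derivative_eq_intros simp: power2_eq_square)
  then have *: "(laguerre_normal_form_deriv a p has_real_derivative
     g * h * (h * P0 + P1) + (- a / (2 * t\<^sup>2) * P0 + P1 * h + P2) * g) (at t)"
    unfolding laguerre_normal_form_deriv_def [abs_def] g_def h_def P0_def P1_def P2_def
    by (intro DERIV_mult DERIV_add poly_DERIV laguerre_factor_deriv t)
  have P2: "P2 = - ((a - t) * P1 + real n * P0) / t"
    using laguerre_odeD[OF ode, of t] t by (simp add: P0_def P1_def P2_def a_def field_simps)
  have "h * (h * P0 + P1) + (- a / (2 * t\<^sup>2) * P0 + P1 * h + P2) = - laguerre_F \<alpha> n t * P0"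
    unfolding P2 h_def laguerre_F_def a_def using t
    by (simp add: field_simps power2_eq_square)
  moreover have "g * h * (h * P0 + P1) + (- a / (2 * t\<^sup>2) * P0 + P1 * h + P2) * g
      = g * (h * (h * P0 + P1) + (- a / (2 * t\<^sup>2) * P0 + P1 * h + P2))"
    by (simp only: distrib_left distrib_right mult_ac)
  ultimately have "g * h * (h * P0 + P1) + (- a / (2 * t\<^sup>2) * P0 + P1 * h + P2) * g
      = - laguerre_F \<alpha> n t * (g * P0)"
    by (simp only: mult.left_commute)
  then show ?thesis
    using * unfolding laguerre_normal_form_def a_def g_def P0_def by simp
qed

lemma laguerre_normal_form_eq_0_iff:
  "t > 0 \<Longrightarrow> laguerre_normal_form a p t = 0 \<longleftrightarrow> poly p t = 0"
  by (simp add: laguerre_normal_form_def)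

lemma laguerre_gap_lower:
  assumes ode: "laguerre_ode (\<alpha> + 1) (real n) p" and uv: "0 < u" "u < v"
    and zeros: "poly p u = 0" "poly p v = 0" "\<And>t. u < t \<Longrightarrow> t < v \<Longrightarrow> poly p t \<noteq> 0"
    and F: "\<And>t. u < t \<Longrightarrow> t < v \<Longrightarrow> laguerre_F \<alpha> n t < M"
  shows "M > 0" "v - u > pi / sqrt M"
proof -
  let ?u = "laguerre_normal_form (\<alpha> + 1) p"
  have d1: "(?u has_real_derivative laguerre_normal_form_deriv (\<alpha> + 1) p t) (at t)"
   and d2: "(laguerre_normal_form_deriv (\<alpha> + 1) p has_real_derivative - laguerre_F \<alpha> n t * ?u t) (at t)"
   if "t \<in> {u..v}" for t
    using that uv laguerre_normal_form_deriv1 laguerre_normal_form_deriv2[OF ode] by auto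
  have z: "?u u = 0" "?u v = 0" "\<And>t. t \<in> {u<..<v} \<Longrightarrow> ?u t \<noteq> 0"
    using uv zeros by (auto simp: laguerre_normal_form_eq_0_iff)
  have F': "\<And>t. t \<in> {u<..<v} \<Longrightarrow> laguerre_F \<alpha> n t < M" using F by auto
  show "M > 0" "v - u > pi / sqrt M"
    using sturm_gap_lower_bound[OF uv(2) d1 d2 z F'] by blast+
qed

lemma laguerre_gap_upper:
  assumes ode: "laguerre_ode (\<alpha> + 1) (real n) p" and uv: "0 < u" "u < v"
    and zeros: "poly p u = 0" "poly p v = 0" "\<And>t. u < t \<Longrightarrow> t < v \<Longrightarrow> poly p t \<noteq> 0"
    and F: "\<And>t. u < t \<Longrightarrow> t < v \<Longrightarrow> laguerre_F \<alpha> n t > M" and M: "M > 0"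
  shows "v - u < pi / sqrt M"
proof -
  let ?u = "laguerre_normal_form (\<alpha> + 1) p"
  have d1: "(?u has_real_derivative laguerre_normal_form_deriv (\<alpha> + 1) p t) (at t)"
   and d2: "(laguerre_normal_form_deriv (\<alpha> + 1) p has_real_derivative - laguerre_F \<alpha> n t * ?u t) (at t)"
   if "t \<in> {u..v}" for t
    using that uv laguerre_normal_form_deriv1 laguerre_normal_form_deriv2[OF ode] by auto
  have z: "?u u = 0" "?u v = 0" "\<And>t. t \<in> {u<..<v} \<Longrightarrow> ?u t \<noteq> 0"
    using uv zeros by (auto simp: laguerre_normal_form_eq_0_iff)
  have F': "\<And>t. t \<in> {u<..<v} \<Longrightarrow> M < laguerre_F \<alpha> n t" using F by auto
  show ?thesis
    using sturm_gap_upper_bound[OF uv(2) d1 d2 z F' M] by blast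
qed

text \<open>
  With $M = F(v)$ at the middle zero $v$, monotonicity of $F$ gives $F < M$ on the right gap and
  $F > M$ on the left gap, hence $v - u < \pi / \sqrt{M} < w - v$. The right gap also shows that
  $M > 0$, which the comparison on the left gap needs.
\<close>

lemma zeros_convex_right_of_t0:
  assumes alpha: "\<alpha> > -1" and ode: "laguerre_ode (\<alpha> + 1) (real n) p"
    and J: "J \<subseteq> {0<..}" "J \<subseteq> {laguerre_t0 \<alpha> n..}" "is_interval J"
  shows "zeros_convex_on (poly p) J"
  unfolding zeros_convex_on_def
proof (intro allI impI, elim conjE)
  fix u v w
  assume uv: "consecutive_zeros_on (poly p) J u v" and vw: "consecutive_zeros_on (poly p) J v w"
  have N: "\<alpha> + 2 * real n + 1 > 0" using alpha by simp
  have mem: "u \<in> J" "v \<in> J" "w \<in> J" and ord: "u < v" "v < w"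
    using uv vw by (auto simp: consecutive_zeros_on_def)
  have between: "t \<in> J" if "r \<in> J" "s \<in> J" "r < t" "t < s" for r s t
    using mem_is_interval_1_I[OF J(3) that(1,2)] that by simp
  have nz: "\<And>t. u < t \<Longrightarrow> t < v \<Longrightarrow> poly p t \<noteq> 0" "\<And>t. v < t \<Longrightarrow> t < w \<Longrightarrow> poly p t \<noteq> 0"
    using uv vw between[OF mem(1,2)] between[OF mem(2,3)]
    unfolding consecutive_zeros_on_def by blast+
  have zeros: "poly p u = 0" "poly p v = 0" "poly p w = 0"
    using uv vw by (auto simp: consecutive_zeros_on_def)
  have pos: "0 < u" "0 < v" using mem J by auto
  have right: "laguerre_F \<alpha> n t < laguerre_F \<alpha> n v" if "v < t" for t
    using mem J that pos by (intro laguerre_F_decreasing N) auto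
  have left: "laguerre_F \<alpha> n t > laguerre_F \<alpha> n v" if "u < t" "t < v" for t
    using mem J that pos between[OF mem(1,2) that] by (intro laguerre_F_decreasing N) auto
  note lower = laguerre_gap_lower[OF ode pos(2) ord(2) zeros(2,3) nz(2) right]
  show "w - v > v - u"
    using lower(2) laguerre_gap_upper[OF ode pos(1) ord(1) zeros(1,2) nz(1) left lower(1)] by simp
qed

text \<open>
  The same comparison at the middle zero, with the roles of the two gaps exchanged.
\<close>

lemma zeros_concave_left_of_t0:
  assumes alpha: "\<alpha> > -1" and ode: "laguerre_ode (\<alpha> + 1) (real n) p"
  shows "zeros_concave_on (poly p) {0<..<laguerre_t0 \<alpha> n}"
  unfolding zeros_concave_on_def
proof (intro allI impI, elim conjE)
  fix u v w
  assume "consecutive_zeros_on (poly p) {0<..<laguerre_t0 \<alpha> n} u v"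
    and "consecutive_zeros_on (poly p) {0<..<laguerre_t0 \<alpha> n} v w"
  then have pos: "0 < u" "0 < v" and ord: "u < v" "v < w" "w < laguerre_t0 \<alpha> n"
    and zeros: "poly p u = 0" "poly p v = 0" "poly p w = 0"
    and nz: "\<And>t. u < t \<Longrightarrow> t < v \<Longrightarrow> poly p t \<noteq> 0" "\<And>t. v < t \<Longrightarrow> t < w \<Longrightarrow> poly p t \<noteq> 0"
    by (auto simp: consecutive_zeros_on_def)
  have N: "\<alpha> + 2 * real n + 1 > 0" using alpha by simp
  have left: "laguerre_F \<alpha> n t < laguerre_F \<alpha> n v" if "u < t" "t < v" for t
    using that ord pos by (intro laguerre_F_increasing N) auto
  have right: "laguerre_F \<alpha> n t > laguerre_F \<alpha> n v" if "v < t" "t < w" for t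
    using that ord pos by (intro laguerre_F_increasing N) auto
  note lower = laguerre_gap_lower[OF ode pos(1) ord(1) zeros(1,2) nz(1) left]
  show "w - v < v - u"
    using lower(2) laguerre_gap_upper[OF ode pos(2) ord(2) zeros(2,3) nz(2) right lower(1)] by simp
qed

lemma zeros_convex_on_superset:
  assumes "zeros_convex_on f J" "J \<subseteq> I" "\<And>t. t \<in> I \<Longrightarrow> f t = 0 \<Longrightarrow> t \<in> J"
  shows "zeros_convex_on f I"
proof -
  have "consecutive_zeros_on f J u v" if "consecutive_zeros_on f I u v" for u v
    using that assms(2,3) unfolding consecutive_zeros_on_def by auto
  then show ?thesis using assms(1) unfolding zeros_convex_on_def by blast
qed

text \<open>
  Since the reciprocals of the zeros are positive and sum to $n / (\alpha + 1)$, no zero is smaller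
  than $(\alpha + 1) / n$; the assumption on \<^term>\<open>n\<close> is exactly that $t_0$ is below this bound.
\<close>

lemma t0_less_zeros:
  assumes alpha: "\<alpha> > -1" and n: "n > 0" and ode: "laguerre_ode (\<alpha> + 1) (real n) p"
    and A: "finite A" "degree p = card A" "p \<noteq> 0" "\<And>r. r \<in> A \<Longrightarrow> poly p r = 0" "\<And>r. r \<in> A \<Longrightarrow> r > 0"
    and small: "real n * (\<alpha> - 3) < \<alpha> + 1" and z: "z \<in> A"
  shows "laguerre_t0 \<alpha> n < z"
proof -
  have "1 / z = (\<Sum>r\<in>{z}. 1 / r)" by simp
  also have "\<dots> \<le> (\<Sum>r\<in>A. 1 / r)"
    using A z by (intro sum_mono2) (auto intro: less_imp_le)
  also have "\<dots> = real n / (\<alpha> + 1)"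
    using A(5)[of 0] alpha by (intro sum_inverse_roots(1)[OF ode _ A(1-4)]) auto
  finally have "(\<alpha> + 1) / real n \<le> z"
    using alpha n A(5)[OF z] by (simp add: field_simps)
  moreover have "laguerre_t0 \<alpha> n < (\<alpha> + 1) / real n"
  proof -
    have N: "\<alpha> + 2 * real n + 1 > 0" using alpha by simp
    have "real n * (\<alpha> - 1) < \<alpha> + 2 * real n + 1" using small by (simp add: algebra_simps)
    then have "(\<alpha> + 1) * (real n * (\<alpha> - 1)) < (\<alpha> + 1) * (\<alpha> + 2 * real n + 1)"
      using alpha by simp
    then have "(\<alpha>\<^sup>2 - 1) * real n < (\<alpha> + 1) * (\<alpha> + 2 * real n + 1)"
      by (simp add: power2_eq_square algebra_simps)
    then show ?thesis unfolding laguerre_t0_def using N n by (simp add: divide_less_eq less_divide_eq)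
  qed
  ultimately show ?thesis by simp
qed

section \<open>The general lower bound for the gaps\<close>

text \<open>
  At a zero of $p$ the equation gives $t (p'' - p') = -a p'$, so $W = p'' - p'$ changes sign
  between consecutive zeros of $p$. This locates $n - 1$ zeros of $W$, as many as its degree, with
  the first of them between the first two zeros of $p$. The sum of the inverse squares of the zeros
  of $W$ is known because $W$ solves a Laguerre equation as well. The first zero of $p$ has no
  comparable bound: it tends to $0$ as $a$ does.
\<close>

lemma reciprocal_second_root_bound:
  fixes x :: "nat \<Rightarrow> real"
  assumes ode: "laguerre_ode a (real n) p" and a: "a > 0"
    and p: "p \<noteq> 0" "degree p = n"
    and mono: "strict_mono_on {1..n} x" and pos: "\<And>i. i \<in> {1..n} \<Longrightarrow> x i > 0"
    and roots: "{t. poly p t = 0} = x ` {1..n}"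
    and j: "2 \<le> j" "j \<le> n"
  shows "(1 / x j)\<^sup>2 \<le> (real n - 1) * (real n + 1 + a) / ((a + 2)\<^sup>2 * (a + 3))"
proof -
  define W where "W = pderiv (pderiv p) - pderiv p"
  have W_ode: "laguerre_ode (a + 2) (real n - 1) W"
    using laguerre_ode_raise_parameter[OF laguerre_ode_pderiv[OF ode]]
    by (simp add: W_def add.assoc)
  have "degree (pderiv (pderiv p)) < degree (- pderiv p)"
    using p(2) j by (simp add: degree_pderiv)
  then have "degree (pderiv (pderiv p) + - pderiv p) = degree (- pderiv p)"
    by (rule degree_add_eq_right)
  then have W_deg: "degree W = n - 1"
    using p(2) by (simp add: W_def degree_pderiv)
  have card: "degree p = card (x ` {1..n})"
    using card_image[OF strict_mono_on_imp_inj_on[OF mono]] p(2) by simp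
  have x_less: "x i < x k" if "i \<in> {1..n}" "k \<in> {1..n}" "i < k" for i k
    using mono that by (auto simp: strict_mono_on_def)
  have "\<exists>t. x i < t \<and> t < x (Suc i) \<and> poly W t = 0" if i: "i \<in> {1..<n}" for i
  proof -
    have x_W: "t * poly W t = - a * poly (pderiv p) t" if "poly p t = 0" for t
      using laguerre_odeD[OF ode, of t] that by (simp add: W_def algebra_simps)
    have gap: "poly p r \<noteq> 0" if r: "x i < r" "r < x (Suc i)" for r
    proof
      assume "poly p r = 0"
      then have "r \<in> x ` {1..n}" using roots by blast
      then obtain k where k: "k \<in> {1..n}" "r = x k" by blast
      have "k \<le> i \<or> k \<ge> Suc i" by auto
      then show False
        using k r i x_less[of k i] x_less[of "Suc i" k] by (cases "k = i \<or> k = Suc i") auto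
    qed
    have xi: "poly p (x i) = 0" "poly p (x (Suc i)) = 0" "x i < x (Suc i)"
      using roots i x_less[of i "Suc i"] by auto
    have "poly (pderiv p) (x i) * poly (pderiv p) (x (Suc i)) < 0"
      using derivative_alternates_at_consecutive_roots[of "x ` {1..n}" p "x i" "x (Suc i)"]
        card p(1) roots i xi gap by auto
    then have "(a * a) * (poly (pderiv p) (x i) * poly (pderiv p) (x (Suc i))) < 0"
      using a by (simp add: mult_pos_neg)
    also have "(a * a) * (poly (pderiv p) (x i) * poly (pderiv p) (x (Suc i)))
        = (x i * poly W (x i)) * (x (Suc i) * poly W (x (Suc i)))"
      using x_W xi by simp
    also have "\<dots> = (x i * x (Suc i)) * (poly W (x i) * poly W (x (Suc i)))"
      by (simp add: mult_ac)
    finally have "poly W (x i) * poly W (x (Suc i)) < 0"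
      using pos[of i] pos[of "Suc i"] i by (simp add: mult_less_0_iff zero_less_mult_iff)
    then show ?thesis using poly_IVT[OF xi(3)] by blast
  qed
  then obtain w where w: "\<And>i. i \<in> {1..<n} \<Longrightarrow> x i < w i \<and> w i < x (Suc i) \<and> poly W (w i) = 0"
    by metis
  have "strict_mono_on {1..<n} w"
  proof (rule strict_mono_onI)
    fix i k assume ik: "i \<in> {1..<n}" "k \<in> {1..<n}" "i < k"
    then have "x (Suc i) \<le> x k"
      using x_less[of "Suc i" k] by (cases "Suc i = k") auto
    then show "w i < w k" using w[OF ik(1)] w[OF ik(2)] by linarith
  qed
  then have W_card: "degree W = card (w ` {1..<n})"
    using W_deg by (simp add: card_image strict_mono_on_imp_inj_on)
  have w_pos: "w i > 0" if "i \<in> {1..<n}" for i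
    using w[OF that] pos[of i] that by auto
  have "W \<noteq> 0" using W_deg j by auto
  have sum: "(\<Sum>r\<in>w ` {1..<n}. 1 / r\<^sup>2)
      = (real n - 1) * (real n - 1 + (a + 2)) / ((a + 2)\<^sup>2 * (a + 2 + 1))"
    by (rule sum_inverse_roots(2)[OF W_ode]) (use a W_card \<open>W \<noteq> 0\<close> w w_pos in force)+
  have one: "1 \<in> {1..<n}" using j by auto
  have "w 1 < x j"
    using w[OF one] x_less[of 2 j] j by (cases "j = 2") (auto simp: numeral_2_eq_2)
  then have "1 / x j \<le> 1 / w 1" "0 \<le> 1 / x j"
    using w_pos[OF one] by (auto simp: field_simps)
  then have "(1 / x j)\<^sup>2 \<le> (1 / w 1)\<^sup>2" by (rule power_mono)
  also have "\<dots> = (\<Sum>r\<in>{w 1}. 1 / r\<^sup>2)" by (simp add: power_divide)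
  also have "\<dots> \<le> (\<Sum>r\<in>w ` {1..<n}. 1 / r\<^sup>2)"
    using one by (intro sum_mono2) auto
  finally show ?thesis unfolding sum by (simp add: add_ac)
qed

text \<open>
  Machin's formula with $\arctan (1/5) \le 1/5$ and the other term dropped.
\<close>

lemma pi_le_16_5: "pi \<le> 16 / 5"
proof -
  have "arctan (1 / 5) \<le> 1 / 5" by (rule arctan_le_self) simp
  moreover have "arctan (1 / 239) \<ge> 0" by simp
  ultimately show ?thesis using machin by linarith
qed

text \<open>
  Here \<^term>\<open>y\<close> stands for the reciprocal of a zero other than the first. The constant $75/64$ is
  $12 / (16/5)^2$ with $16/5$ as an upper bound of $\pi$. The left hand side is bounded by
  $S / ((a + 2) \sqrt{a + 3})$, and $\sqrt{a + 3} \ge \sqrt{3}$ is replaced by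
  $\sqrt{3} \ge 433/250$.
\<close>

lemma gap_estimate_arithmetic:
  fixes a y m :: real
  assumes a: "a > 0" and m: "m \<ge> 2" and y: "y\<^sup>2 \<le> (m - 1) * (m + 1 + a) / ((a + 2)\<^sup>2 * (a + 3))"
  shows "2 * (2 * m + a) * y \<le> 75 / 64 * (m\<^sup>2 + a * m + a / 2)"
proof -
  define N where "N = m\<^sup>2 + a * m"
  define S T where "S = 4 * N + a\<^sup>2 / 2 - 2 - 2 * a" and "T = 75 / 64 * (N + a / 2)"
  have "m * (m + a) \<ge> 2 * (2 + a)" using a m by (intro mult_mono) auto
  then have N: "N \<ge> 4 + 2 * a" by (simp add: N_def power2_eq_square algebra_simps)
  have T: "T \<ge> 0" using a N by (simp add: T_def)
  have S: "S \<ge> 0" using N a zero_le_power2[of a] unfolding S_def by linarith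
  \<comment> \<open>The factors add up to $2 S$, so this is the inequality of the arithmetic and geometric means.\<close>
  have amgm: "(2 * m + a)\<^sup>2 * (4 * ((m - 1) * (m + 1 + a))) \<le> S\<^sup>2"
  proof -
    have "S\<^sup>2 - (2 * m + a)\<^sup>2 * (4 * ((m - 1) * (m + 1 + a))) = (a\<^sup>2 / 2 + 2 + 2 * a)\<^sup>2"
      by (simp add: S_def N_def power2_eq_square algebra_simps)
    then show ?thesis using zero_le_power2[of "a\<^sup>2 / 2 + 2 + 2 * a"] by linarith
  qed
  have ST: "S \<le> 433 / 250 * ((a + 2) * T)"
  proof -
    have "(a + 2) * T = 75 / 64 * (2 * N) + 75 / 64 * (a * N) + 75 / 128 * a\<^sup>2 + 75 / 64 * a"
      by (simp add: T_def power2_eq_square field_simps)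
    moreover have "a * N \<ge> 0" using a N by simp
    moreover define P Q R where "P = a * N" and "Q = a\<^sup>2" and "R = (a + 2) * T"
    ultimately have "R = 75 / 64 * (2 * N) + 75 / 64 * P + 75 / 128 * Q + 75 / 64 * a" "P \<ge> 0" "Q \<ge> 0"
      by auto
    then have "4 * N + Q / 2 - 2 - 2 * a \<le> 433 / 250 * R" using N a by linarith
    then show ?thesis by (simp add: S_def Q_def R_def)
  qed
  have "(2 * (2 * m + a) * y)\<^sup>2 = 4 * (2 * m + a)\<^sup>2 * y\<^sup>2"
    unfolding power2_eq_square by (simp only: mult_ac)
  also have "\<dots> \<le> 4 * (2 * m + a)\<^sup>2 * ((m - 1) * (m + 1 + a) / ((a + 2)\<^sup>2 * (a + 3)))"
    using y by (intro mult_left_mono) auto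
  also have "\<dots> = (2 * m + a)\<^sup>2 * (4 * ((m - 1) * (m + 1 + a))) / ((a + 2)\<^sup>2 * (a + 3))"
    by simp
  also have "\<dots> \<le> S\<^sup>2 / ((a + 2)\<^sup>2 * (a + 3))"
    using amgm a by (intro divide_right_mono) auto
  also have "\<dots> \<le> (433 / 250 * ((a + 2) * T))\<^sup>2 / ((a + 2)\<^sup>2 * (a + 3))"
    using ST S a by (intro divide_right_mono power_mono) auto
  also have "(433 / 250 * ((a + 2) * T))\<^sup>2 = (a + 2)\<^sup>2 * ((433 / 250)\<^sup>2 * T\<^sup>2)"
    by (simp only: power_mult_distrib mult_ac)
  also have "\<dots> / ((a + 2)\<^sup>2 * (a + 3)) = (433 / 250)\<^sup>2 * T\<^sup>2 / (a + 3)"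
    using a by (intro mult_divide_mult_cancel_left) simp
  also have "\<dots> \<le> T\<^sup>2"
  proof -
    have "(433 / 250)\<^sup>2 * T\<^sup>2 \<le> (a + 3) * T\<^sup>2"
      using a by (intro mult_right_mono) (simp_all add: power2_eq_square)
    then show ?thesis using a by (simp add: field_simps)
  qed
  finally have "(2 * (2 * m + a) * y)\<^sup>2 \<le> T\<^sup>2" .
  then show ?thesis using T power2_le_imp_le unfolding T_def N_def by blast
qed

text \<open>
  The identity for the inverse square gaps is applied at the right end of the gap, where the
  reciprocal of the zero is under control even for the first gap.
\<close>

lemma general_gap_estimate:
  fixes x :: "nat \<Rightarrow> real"
  assumes ode: "laguerre_ode a (real n) p" and a: "a > 0"
    and p: "p \<noteq> 0" "degree p = n"
    and mono: "strict_mono_on {1..n} x" and pos: "\<And>i. i \<in> {1..n} \<Longrightarrow> x i > 0"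
    and roots: "{t. poly p t = 0} = x ` {1..n}"
    and k: "1 \<le> k" "k + 1 \<le> n"
  shows "x (k + 1) - x k > pi * sqrt 2 / sqrt (2 * ((real n)\<^sup>2 + a * real n + a / 2))"
proof -
  define z d M where "z = x (k + 1)" and "d = x (k + 1) - x k" and "M = (real n)\<^sup>2 + a * real n + a / 2"
  have d: "d > 0" using mono k by (auto simp: d_def strict_mono_on_def)
  have z: "z > 0" unfolding z_def using k by (intro pos) auto
  have M: "M > 0" using a k by (simp add: M_def add_pos_nonneg)
  have card: "degree p = card (x ` {1..n})"
    using card_image[OF strict_mono_on_imp_inj_on[OF mono]] p(2) by simp
  have "12 * (1 / d\<^sup>2) = 12 * (\<Sum>r\<in>{x k}. 1 / (z - r)\<^sup>2)" by (simp add: d_def z_def)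
  also have "\<dots> \<le> 12 * (\<Sum>r\<in>x ` {1..n} - {z}. 1 / (z - r)\<^sup>2)"
    using k d by (intro mult_left_mono sum_mono2) (auto simp: z_def d_def)
  also have "\<dots> = - 1 + 2 * (2 * real n + a) / z - a * (a + 4) / z\<^sup>2"
    by (rule sum_inverse_square_gaps[OF ode _ card])
       (use roots p(1) k z in \<open>auto simp: z_def\<close>)
  also have "\<dots> < 2 * (2 * real n + a) * (1 / z)"
  proof -
    have "a * (a + 4) / z\<^sup>2 > 0" using a z by simp
    then show ?thesis by simp
  qed
  also have "\<dots> \<le> 75 / 64 * M"
    unfolding M_def
  proof (rule gap_estimate_arithmetic[OF a])
    show "real n \<ge> 2" using k by simp
    show "(1 / z)\<^sup>2 \<le> (real n - 1) * (real n + 1 + a) / ((a + 2)\<^sup>2 * (a + 3))"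
      unfolding z_def
      using reciprocal_second_root_bound[OF ode a p mono pos roots, of "k + 1"] k by simp
  qed
  finally have "12 * (1 / d\<^sup>2) < 75 / 64 * M" .
  then have "(16 / 5)\<^sup>2 < d\<^sup>2 * M"
    using d by (simp add: field_simps power2_eq_square)
  moreover have "pi\<^sup>2 \<le> (16 / 5)\<^sup>2" using pi_le_16_5 by (intro power_mono) auto
  ultimately have "pi\<^sup>2 < d\<^sup>2 * M" by linarith
  then have "(pi * sqrt 2)\<^sup>2 < (d * sqrt (2 * M))\<^sup>2"
    using M by (simp add: power_mult_distrib)
  then have "pi * sqrt 2 < d * sqrt (2 * M)"
    by (rule power2_less_imp_less) (use d M in auto)
  then show ?thesis
    using M unfolding d_def[symmetric] M_def[symmetric] by (simp add: divide_less_eq mult.commute)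
qed

section \<open>Zeros of Laguerre polynomials\<close>

theorem theorem3p1:
  fixes \<alpha> :: real and n :: nat and L :: "real poly" and x :: "nat \<Rightarrow> real"
  assumes alpha: "\<alpha> > -1"
    and n: "n > 0"
    and L: "laguerre_poly \<alpha> n L"
    and x_mono: "strict_mono_on {1..n} x"
    and x_zeros: "x ` {1..n} = {t. t > 0 \<and> poly L t = 0}"
  shows "(\<alpha> \<le> 3 \<longrightarrow> zeros_convex_on (poly L) {0<..})
    \<and> (\<alpha> > 3 \<and> real n < (\<alpha> + 1) / (\<alpha> - 3) \<longrightarrow> zeros_convex_on (poly L) {0<..})
    \<and> (\<alpha> > 3 \<and> real n > (\<alpha> + 1) / (\<alpha> - 3) \<longrightarrow>
         zeros_concave_on (poly L) {0<..<laguerre_t0 \<alpha> n}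
         \<and> zeros_convex_on (poly L) {laguerre_t0 \<alpha> n<..})
    \<and> (\<forall>k. 1 \<le> k \<and> k + 1 \<le> n \<longrightarrow>
         x (k + 1) - x k
           > pi * sqrt 2 / sqrt (2 * \<alpha> * real n + \<alpha> + 2 * (real n)\<^sup>2 + 2 * real n + 1))
    \<and> (\<forall>k. 1 \<le> k \<and> k + 1 \<le> n \<and> x k > laguerre_t0 \<alpha> n \<longrightarrow>
         laguerre_F \<alpha> n (x k) > 0
         \<and> x (k + 1) - x k > pi / sqrt (laguerre_F \<alpha> n (x k)))
    \<and> (\<forall>k. 1 \<le> k \<and> k + 2 \<le> n \<and> x k > laguerre_t0 \<alpha> n \<longrightarrow>
         laguerre_F \<alpha> n (x (k + 1)) > 0
         \<and> x (k + 1) - x k < pi / sqrt (laguerre_F \<alpha> n (x (k + 1))))"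
proof -
  let ?A = "x ` {1..n}"
  have ode: "laguerre_ode (\<alpha> + 1) (real n) L"
    by (rule laguerre_poly_imp_ode[OF alpha n L])
  have L0: "L \<noteq> 0" and degL: "degree L = n" using L by (auto simp: laguerre_poly_def)
  have card: "degree L = card ?A"
    using degL card_image[OF strict_mono_on_imp_inj_on[OF x_mono]] by simp
  have zeros: "poly L r = 0" and zeros_pos: "r > 0" if "r \<in> ?A" for r
    using that x_zeros by auto
  have roots: "{t. poly L t = 0} = ?A"
    by (rule roots_eq_if_card_eq_degree[OF _ card L0]) (auto intro: zeros)
  have pos: "x i > 0" if "i \<in> {1..n}" for i using that zeros_pos by blast
  have N: "\<alpha> + 2 * real n + 1 > 0" using alpha by simp
  have convex_right: "zeros_convex_on (poly L) {max 0 (laguerre_t0 \<alpha> n)<..}"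
    by (rule zeros_convex_right_of_t0[OF alpha ode]) auto
  have all_convex: "zeros_convex_on (poly L) {0<..}" if "real n * (\<alpha> - 3) < \<alpha> + 1"
  proof (rule zeros_convex_on_superset[OF convex_right])
    fix t assume t: "t \<in> {0<..}" "poly L t = 0"
    then have "t \<in> ?A" using x_zeros by auto
    then have "laguerre_t0 \<alpha> n < t"
      using t0_less_zeros[OF alpha n ode _ card L0 zeros zeros_pos that] by auto
    then show "t \<in> {max 0 (laguerre_t0 \<alpha> n)<..}" using t by auto
  qed auto
  have "zeros_convex_on (poly L) {0<..}" if "\<alpha> \<le> 3"
  proof (rule all_convex)
    have "real n * (\<alpha> - 3) \<le> 0" using that by (intro mult_nonneg_nonpos) auto
    then show "real n * (\<alpha> - 3) < \<alpha> + 1" using alpha by linarith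
  qed
  moreover have "zeros_convex_on (poly L) {0<..}" if "\<alpha> > 3" "real n < (\<alpha> + 1) / (\<alpha> - 3)"
    using that by (intro all_convex) (simp add: less_divide_eq)
  moreover have "zeros_concave_on (poly L) {0<..<laguerre_t0 \<alpha> n}"
    by (rule zeros_concave_left_of_t0[OF alpha ode])
  moreover have "zeros_convex_on (poly L) {laguerre_t0 \<alpha> n<..}" if "\<alpha> > 3"
  proof -
    have "laguerre_t0 \<alpha> n \<ge> 0"
      using that N by (simp add: laguerre_t0_def one_le_power)
    then show ?thesis using convex_right by (simp add: max_def)
  qed
  moreover have "x (k + 1) - x k
      > pi * sqrt 2 / sqrt (2 * \<alpha> * real n + \<alpha> + 2 * (real n)\<^sup>2 + 2 * real n + 1)"
    if "1 \<le> k" "k + 1 \<le> n" for k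
  proof -
    have "2 * ((real n)\<^sup>2 + (\<alpha> + 1) * real n + (\<alpha> + 1) / 2)
        = 2 * \<alpha> * real n + \<alpha> + 2 * (real n)\<^sup>2 + 2 * real n + 1"
      by (simp add: field_simps)
    moreover have "\<alpha> + 1 > 0" using alpha by simp
    ultimately show ?thesis
      using general_gap_estimate[OF ode _ L0 degL x_mono pos roots that] by (simp only:)
  qed
  moreover
  have gap: "x k < x (k + 1)" "poly L (x k) = 0" "poly L (x (k + 1)) = 0"
      "\<And>t. x k < t \<Longrightarrow> t < x (k + 1) \<Longrightarrow> poly L t \<noteq> 0" "x k > 0"
    if k: "1 \<le> k" "k + 1 \<le> n" for k
  proof -
    have less: "x i < x j" if "i \<in> {1..n}" "j \<in> {1..n}" "i < j" for i j
      using x_mono that by (auto simp: strict_mono_on_def)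
    show "x k < x (k + 1)" "poly L (x k) = 0" "poly L (x (k + 1)) = 0" "x k > 0"
      using k less pos zeros by auto
    fix t assume t: "x k < t" "t < x (k + 1)"
    show "poly L t \<noteq> 0"
    proof
      assume "poly L t = 0"
      then have "t \<in> ?A" using roots by blast
      then obtain i where i: "i \<in> {1..n}" "t = x i" by blast
      show False
        using i t k less[of i k] less[of "k + 1" i]
        by (cases "i < k"; cases "i = k"; cases "i = k + 1") auto
    qed
  qed
  have lower: "laguerre_F \<alpha> n (x k) > 0 \<and> x (k + 1) - x k > pi / sqrt (laguerre_F \<alpha> n (x k))"
    if k: "1 \<le> k" "k + 1 \<le> n" "x k > laguerre_t0 \<alpha> n" for k
  proof -
    have "laguerre_F \<alpha> n t < laguerre_F \<alpha> n (x k)" if "x k < t" for t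
      using gap(5)[OF k(1,2)] k(3) that by (intro laguerre_F_decreasing N) auto
    then show ?thesis
      using laguerre_gap_lower[OF ode gap(5,1-4)[OF k(1,2)]] by blast
  qed
  moreover have "laguerre_F \<alpha> n (x (k + 1)) > 0 \<and> x (k + 1) - x k < pi / sqrt (laguerre_F \<alpha> n (x (k + 1)))"
    if k: "1 \<le> k" "k + 2 \<le> n" "x k > laguerre_t0 \<alpha> n" for k
  proof -
    have k1: "k + 1 \<le> n" using k by simp
    have F: "laguerre_F \<alpha> n (x (k + 1)) > 0"
      \<comment> \<open>Positivity of $F$ at $x_{k+1}$ comes from the gap that follows, which is why $k \le n - 2$.\<close>
      using lower[of "k + 1"] k gap(1)[OF k(1) k1] by simp
    have "laguerre_F \<alpha> n (x (k + 1)) < laguerre_F \<alpha> n t" if "x k < t" "t < x (k + 1)" for t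
      using gap(5)[OF k(1) k1] k(3) that by (intro laguerre_F_decreasing N) auto
    then show ?thesis
      using F laguerre_gap_upper[OF ode gap(5,1-4)[OF k(1) k1]] by blast
  qed
  ultimately show ?thesis by blast
qed

end
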